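(* Let $p^\star=\sum_{\ell=1}^m\pi^\star_\ell\phi(\cdot\mid\mu^\star_\ell)$ with $\pi^\star_{\min}:=\min_\ell\pi_\ell^\star>0$. Let $[n]=\bigsqcup_{\ell=1}^mS_\ell$ be a fixed partition into nonempty sets, let $\pi\in\Delta^{n-1}$ have strictly positive entries, and let $\Delta_\pi$ and the reference weights $\bar\pi$ be as defined in the context. Fix a compact set $U\subset\mathbb R^{dn}$ and suppose $\Delta_\pi\le\frac12$. Define $$M_U=\max_{\mu\in U}\max_{i\in[n]}\|\mu_i\|_2,\qquad m_2=\mathbb E_{X\sim p^\star}\|X\|^2,\qquad c_0=\tfrac12\pi^\star_{\min},\qquad C_0=2\Bigl(1+\frac1{\pi^\star_{\min}}\Bigr).$$ Then $$\sup_{\mu\in U}|\mathcal L(\mu,\pi)-\mathcal L(\mu,\bar\pi)|\le C_U^{(0)}\Delta_\pi,\qquad \sup_{\mu\in U}\|\nabla_\mu\mathcal L(\mu,\pi)-\nabla_\mu\mathcal L(\mu,\bar\pi)\|\le C_U^{(1)}\Delta_\pi,$$ $$\sup_{\mu\in U}\|\nabla^2_{\mu\mu}\mathcal L(\mu,\pi)-\nabla^2_{\mu\mu}\mathcal L(\mu,\bar\pi)\|_{\mathrm{op}}\le C_U^{(2)}\Delta_\pi,$$ where $$C_U^{(0)}=\frac1{c_0},\qquad C_U^{(1)}=C_0\sqrt{2n(m_2+M_U^2)},\qquad C_U^{(2)}=C_0n\bigl(1+2(2+C_0\Delta_\pi)(m_2+M_U^2)\bigr).$$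
   Context: $\phi(x\mid\mu)=(2\pi)^{-d/2}e^{-\|x-\mu\|^2/2}$ on $\mathbb R^d$; $\Delta^{n-1}$ is the probability simplex. For $\mu=(\mu_1,\dots,\mu_n)\in\mathbb R^{dn}$ and $\pi\in\Delta^{n-1}$, $p_{\mu,\pi}=\sum_{i=1}^n\pi_i\phi(\cdot\mid\mu_i)$ and $\mathcal L(\mu,\pi)=\mathbb E_{X\sim p^\star}[\log(p^\star(X)/p_{\mu,\pi}(X))]$. Derivatives are in $\mu$ with the weights fixed; $\|\cdot\|_{\mathrm{op}}$ is the spectral norm. Cluster weights: $\widehat\pi_\ell=\sum_{i\in S_\ell}\pi_i$. Weight mismatch: $\Delta_\pi=\max_{\ell\in[m]}|\widehat\pi_\ell-\pi_\ell^\star|/\pi_\ell^\star$. Reference weights: $\bar\pi_i=\pi_i\,\pi_\ell^\star/\widehat\pi_\ell$ for $i\in S_\ell$, $\ell\in[m]$ (so $\sum_{i\in S_\ell}\bar\pi_i=\pi_\ell^\star$). *)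

theory Defs
  imports "HOL-Probability.Probability"
begin

definition gauss_density :: "real ^ 'd \<Rightarrow> real ^ 'd \<Rightarrow> real" where
  "gauss_density m x = (2 * pi) powr (- real CARD('d) / 2) * exp (- (norm (x - m))\<^sup>2 / 2)"

definition prob_simplex :: "('n::finite \<Rightarrow> real) set" where
  "prob_simplex = {w. (\<forall>i. 0 \<le> w i) \<and> (\<Sum>i\<in>UNIV. w i) = 1}"

text \<open>A tuple of \<open>n\<close> means in \<open>d\<close>-space is a vector of vectors; the inner product and norm of
  the type \<open>(real ^ 'd) ^ 'n\<close> are the Euclidean ones of the space of dimension \<open>d n\<close>.\<close>

definition mixture :: "(real ^ 'd) ^ 'n \<Rightarrow> ('n \<Rightarrow> real) \<Rightarrow> real ^ 'd \<Rightarrow> real" where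
  "mixture \<mu> w x = (\<Sum>i\<in>UNIV. w i * gauss_density (\<mu> $ i) x)"

definition mixture_measure :: "(real ^ 'd) ^ 'n \<Rightarrow> ('n \<Rightarrow> real) \<Rightarrow> (real ^ 'd) measure" where
  "mixture_measure \<mu> w = density lborel (\<lambda>x. ennreal (mixture \<mu> w x))"

definition log_ratio ::
  "(real ^ 'd) ^ 'm \<Rightarrow> ('m \<Rightarrow> real) \<Rightarrow> (real ^ 'd) ^ 'n \<Rightarrow> ('n \<Rightarrow> real) \<Rightarrow> real ^ 'd \<Rightarrow> real" where
  "log_ratio \<mu>s ws \<mu> w x = ln (mixture \<mu>s ws x / mixture \<mu> w x)"

definition pop_loss ::
  "(real ^ 'd) ^ 'm \<Rightarrow> ('m \<Rightarrow> real) \<Rightarrow> (real ^ 'd) ^ 'n \<Rightarrow> ('n \<Rightarrow> real) \<Rightarrow> real" where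
  "pop_loss \<mu>s ws \<mu> w = (\<integral>x. log_ratio \<mu>s ws \<mu> w x \<partial>mixture_measure \<mu>s ws)"

definition second_moment :: "(real ^ 'd) ^ 'm \<Rightarrow> ('m \<Rightarrow> real) \<Rightarrow> real" where
  "second_moment \<mu>s ws = (\<integral>x. (norm x)\<^sup>2 \<partial>mixture_measure \<mu>s ws)"

definition cluster_weight :: "('m \<Rightarrow> 'n set) \<Rightarrow> ('n \<Rightarrow> real) \<Rightarrow> 'm \<Rightarrow> real" where
  "cluster_weight S w l = (\<Sum>i\<in>S l. w i)"

definition weight_mismatch ::
  "('m::finite \<Rightarrow> 'n set) \<Rightarrow> ('m \<Rightarrow> real) \<Rightarrow> ('n \<Rightarrow> real) \<Rightarrow> real" where
  "weight_mismatch S ws w = (MAX l. \<bar>cluster_weight S w l - ws l\<bar> / ws l)"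

text \<open>Meaningful only if every \<open>i\<close> lies in exactly one of the sets \<open>S l\<close>.\<close>

definition ref_weight :: "('m \<Rightarrow> 'n set) \<Rightarrow> ('m \<Rightarrow> real) \<Rightarrow> ('n \<Rightarrow> real) \<Rightarrow> 'n \<Rightarrow> real" where
  "ref_weight S ws w i = (let l = (THE l. i \<in> S l) in w i * ws l / cluster_weight S w l)"

text \<open>The following two are unspecified where the (second) derivative does not exist. The Hessian
  is the linear operator \<open>h \<mapsto> D (grad f) x h\<close>, so that its spectral norm is its
  \<^const>\<open>onorm\<close>.\<close>

definition grad :: "('a::real_inner \<Rightarrow> real) \<Rightarrow> 'a \<Rightarrow> 'a" where
  "grad f x = (THE D. GDERIV f x :> D)"

definition hess :: "('a::real_inner \<Rightarrow> real) \<Rightarrow> 'a \<Rightarrow> 'a \<Rightarrow> 'a" where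
  "hess f x = frechet_derivative (grad f) (at x)"

text \<open>On a nonempty compact set this supremum is attained, i.e. it is the maximum.\<close>

definition max_mean_norm :: "((real ^ 'd) ^ 'n) set \<Rightarrow> real" where
  "max_mean_norm U = (SUP \<mu>\<in>U. MAX i. norm (\<mu> $ i))"

end

theory Submission imports Defs begin

text \<open>Both weight vectors give every component a weight that agrees up to a factor
  \<open>1 \<plusminus> \<Delta>\<close>, hence so do the two mixture densities, pointwise in \<open>x\<close>, and the posterior
  weights (responsibilities) \<open>\<gamma>\<^sub>i\<close> agree up to a relative error \<open>4 \<Delta> \<le> C0 \<Delta>\<close>. Gradient and Hessian
  of the loss are expectations of expressions in the \<open>\<gamma>\<^sub>i\<close> and \<open>\<mu>\<^sub>i - x\<close>: with
  \<open>s\<^sub>i = (\<mu>\<^sub>i - x) \<bullet> h\<^sub>i\<close> and \<open>a = \<Sum>\<^sub>j \<gamma>\<^sub>j s\<^sub>j\<close> they are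
  \<open>E[\<gamma>\<^sub>i (\<mu>\<^sub>i - x)]\<close> and \<open>E[\<gamma>\<^sub>i (h\<^sub>i + (a - s\<^sub>i) (\<mu>\<^sub>i - x))]\<close>. The errors are estimated
  pointwise through \<open>\<parallel>\<mu>\<^sub>i - x\<parallel>\<^sup>2 \<le> R\<^sup>2 = 2 (\<parallel>x\<parallel>\<^sup>2 + M\<^sup>2)\<close> and integrated. Differentiation under
  the integral sign is dominated convergence along sequences.\<close>

section \<open>Elementary norm inequalities\<close>

lemma norm_diff_sq_le:
  fixes x y :: "'a::real_normed_vector"
  shows "(norm (x - y))\<^sup>2 \<le> 2 * ((norm x)\<^sup>2 + (norm y)\<^sup>2)"
proof -
  have "(norm (x - y))\<^sup>2 \<le> (norm x + norm y)\<^sup>2"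
    by (intro power_mono norm_triangle_ineq4 norm_ge_zero)
  also have "\<dots> \<le> 2 * ((norm x)\<^sup>2 + (norm y)\<^sup>2)"
    using zero_le_power2[of "norm x - norm y"] by (simp add: power2_eq_square algebra_simps)
  finally show ?thesis .
qed

lemma norm_diff_le_sqrt:
  fixes x y :: "'a::real_normed_vector"
  assumes "norm x \<le> M"
  shows "norm (x - y) \<le> sqrt (2 * ((norm y)\<^sup>2 + M\<^sup>2))"
  using norm_diff_sq_le[of x y] power_mono[OF assms, of 2] by (intro real_le_rsqrt) auto

section \<open>The Gaussian density: normalisation and second moment\<close>

lemma gauss_density_pos: "gauss_density m x > 0"
  by (simp add: gauss_density_def)

lemma gauss_density_le: "gauss_density (m :: real ^ 'd) x \<le> (2 * pi) powr (- real CARD('d) / 2)"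
  by (simp add: gauss_density_def mult_left_le)

text \<open>The squared norm is a sum over an orthonormal basis, so the exponential factorises.
  Integrals in \<open>d\<close> dimensions thereby reduce to moments of one-dimensional normal
  densities.\<close>

lemma gauss_density_prod:
  fixes m :: "real ^ 'd"
  shows "gauss_density m x = (\<Prod>b\<in>Basis. normal_density (m \<bullet> b) 1 (x \<bullet> b))"
proof -
  have "(norm (x - m))\<^sup>2 = (\<Sum>b\<in>Basis. (x \<bullet> b - m \<bullet> b)\<^sup>2)"
    unfolding power2_norm_eq_inner
    by (subst euclidean_inner) (simp add: inner_diff_left power2_eq_square)
  moreover have "(2 * pi) powr (- real CARD('d) / 2) = (1 / sqrt (2 * pi)) ^ CARD('d)"
    by (simp add: powr_half_sqrt[symmetric] powr_minus_divide[symmetric] powr_realpow[symmetric] powr_powr)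
  ultimately show ?thesis
    by (simp add: gauss_density_def normal_density_def prod_dividef exp_sum
        sum_divide_distrib sum_negf[symmetric] power_one_over)
qed

lemma gauss_density_measurable [measurable]: "gauss_density m \<in> borel_measurable borel"
  unfolding gauss_density_def by measurable

lemma nn_integral_gauss_density:
  fixes m :: "real ^ 'd"
  shows "(\<integral>\<^sup>+x. ennreal (gauss_density m x) \<partial>lborel) = 1"
proof -
  have 1: "(\<integral>\<^sup>+t. ennreal (normal_density a 1 t) \<partial>lborel) = 1" for a
    by (subst nn_integral_eq_integral) auto
  show ?thesis
    by (simp add: gauss_density_prod prod_ennreal[symmetric])
      (subst nn_integral_lborel_prod; simp add: 1)
qed

text \<open>First the second moment about \<open>m\<close>, one coordinate at a time: each is a
  product integral in which a single factor carries the square. Then \<open>norm x\<close> is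
  compared with \<open>norm (x - m)\<close>, at the cost of a multiple of the density
  itself.\<close>

lemma integrable_gauss_density_sq:
  fixes m :: "real ^ 'd"
  shows "integrable lborel (\<lambda>x. gauss_density m x * (norm x)\<^sup>2)"
proof -
  have "integrable lborel (\<lambda>x. gauss_density m x * ((x - m) \<bullet> c)\<^sup>2)" if c: "c \<in> Basis" for c :: "real ^ 'd"
  proof (rule integrableI_bounded)
    \<comment> \<open>The square sits in the factor for \<open>c\<close> only; all other factors are
      plain densities.\<close>
    let ?f = "\<lambda>b t. normal_density (m \<bullet> b) 1 t * (if b = c then (t - m \<bullet> b)\<^sup>2 else 1)"
    have "gauss_density m x * ((x - m) \<bullet> c)\<^sup>2 = (\<Prod>b\<in>Basis. ?f b (x \<bullet> b))" for x
      using c by (simp add: gauss_density_prod prod.distrib prod.delta inner_diff_left)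
    then have "(\<integral>\<^sup>+x. ennreal (norm (gauss_density m x * ((x - m) \<bullet> c)\<^sup>2)) \<partial>lborel)
        = (\<integral>\<^sup>+x. (\<Prod>b\<in>Basis. ennreal (?f b (x \<bullet> b))) \<partial>lborel)"
      by (simp add: prod_ennreal prod_nonneg)
    also have "\<dots> = (\<Prod>b\<in>Basis. (\<integral>\<^sup>+t. ennreal (?f b t) \<partial>lborel))"
      by (rule nn_integral_lborel_prod) auto
    also have "\<dots> < \<infinity>"
    proof -
      have "integrable lborel (?f b)" for b
        using integrable_normal_moment[where \<mu> = "m \<bullet> b" and \<sigma> = 1 and k = 2] by (cases "b = c") auto
      then have "(\<integral>\<^sup>+t. ennreal (?f b t) \<partial>lborel) < top" for b
        by (subst nn_integral_eq_integral) auto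
      then show ?thesis
        by (simp add: less_top[symmetric] ennreal_prod_eq_top)
    qed
    finally show "(\<integral>\<^sup>+x. ennreal (norm (gauss_density m x * ((x - m) \<bullet> c)\<^sup>2)) \<partial>lborel) < \<infinity>" .
  qed measurable
  then have "integrable lborel (\<lambda>x. \<Sum>c\<in>Basis. gauss_density m x * ((x - m) \<bullet> c)\<^sup>2)"
    by (rule Bochner_Integration.integrable_sum)
  also have "(\<lambda>x. \<Sum>c\<in>Basis. gauss_density m x * ((x - m) \<bullet> c)\<^sup>2) = (\<lambda>x. gauss_density m x * (norm (x - m))\<^sup>2)"
    unfolding power2_norm_eq_inner
    by (subst (2) euclidean_inner) (simp add: power2_eq_square sum_distrib_left)
  finally have sq: "integrable lborel (\<lambda>x. gauss_density m x * (norm (x - m))\<^sup>2)" .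
  have "integrable lborel (gauss_density m)"
    by (rule integrableI_bounded)
      (auto simp: nn_integral_gauss_density gauss_density_pos less_imp_le)
  with sq have "integrable lborel (\<lambda>x. 2 * (gauss_density m x * (norm (x - m))\<^sup>2) + 2 * (norm m)\<^sup>2 * gauss_density m x)"
    by auto
  then show ?thesis
  proof (rule Bochner_Integration.integrable_bound, goal_cases)
    case 2
    have "(norm x)\<^sup>2 \<le> 2 * (norm (x - m))\<^sup>2 + 2 * (norm m)\<^sup>2" for x
      using norm_diff_sq_le[of "x - m" "- m"] by simp
    then have "gauss_density m x * (norm x)\<^sup>2 \<le> gauss_density m x * (2 * (norm (x - m))\<^sup>2 + 2 * (norm m)\<^sup>2)" for x
      by (intro mult_left_mono) (auto simp: gauss_density_pos less_imp_le)
    then show ?case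
      using gauss_density_pos[of m] by (intro AE_I2) (auto simp: algebra_simps abs_of_pos less_imp_le)
  qed measurable
qed

section \<open>Mixture densities and their measures\<close>

lemma mixture_pos:
  fixes v :: "'n::finite \<Rightarrow> real"
  assumes "\<And>i. v i > 0"
  shows "mixture \<mu> v x > 0"
  unfolding mixture_def by (intro sum_pos mult_pos_pos assms gauss_density_pos) auto

lemma mixture_measurable [measurable]: "mixture \<mu> v \<in> borel_measurable borel"
  unfolding mixture_def by measurable

lemma sets_mixture_measure [simp, measurable_cong]: "sets (mixture_measure \<mu> v) = sets borel"
  by (simp add: mixture_measure_def)

lemma space_mixture_measure [simp]: "space (mixture_measure \<mu> v) = UNIV"
  by (simp add: mixture_measure_def)

lemma prob_space_mixture_measure:
  assumes "v \<in> prob_simplex"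
  shows "prob_space (mixture_measure \<mu> v)"
proof
  have nn: "0 \<le> v i" for i
    using assms by (simp add: prob_simplex_def)
  have "emeasure (mixture_measure \<mu> v) UNIV = (\<integral>\<^sup>+x. ennreal (\<Sum>i\<in>UNIV. v i * gauss_density (\<mu> $ i) x) \<partial>lborel)"
    by (simp add: mixture_measure_def emeasure_density mixture_def)
  also have "\<dots> = (\<integral>\<^sup>+x. (\<Sum>i\<in>UNIV. ennreal (v i) * ennreal (gauss_density (\<mu> $ i) x)) \<partial>lborel)"
    by (simp add: sum_ennreal[symmetric] nn gauss_density_pos less_imp_le ennreal_mult)
  also have "\<dots> = (\<Sum>i\<in>UNIV. ennreal (v i))"
    by (simp add: nn_integral_sum nn_integral_cmult nn_integral_gauss_density)
  also have "\<dots> = 1"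
    using assms nn by (simp add: sum_ennreal prob_simplex_def)
  finally show "emeasure (mixture_measure \<mu> v) (space (mixture_measure \<mu> v)) = 1"
    by simp
qed

lemma integrable_mixture_measure_sq:
  assumes "\<And>i. v i > 0"
  shows "integrable (mixture_measure \<mu> v) (\<lambda>x. (norm x)\<^sup>2)"
proof -
  have "integrable lborel (\<lambda>x. \<Sum>i\<in>UNIV. v i * (gauss_density (\<mu> $ i) x * (norm x)\<^sup>2))"
    by (intro Bochner_Integration.integrable_sum integrable_mult_right integrable_gauss_density_sq)
  then show ?thesis
    unfolding mixture_measure_def using mixture_pos[of v \<mu>] assms
    by (subst integrable_real_density)
      (auto simp: less_imp_le mixture_def sum_distrib_left sum_distrib_right mult_ac)
qed

section \<open>Differentiation under the integral sign\<close>

lemma norm_lebesgue_integral_le: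
  fixes f :: "'a \<Rightarrow> 'b::{banach, second_countable_topology}"
  assumes "integrable M f" "integrable M g" "\<And>x. norm (f x) \<le> g x"
  shows "norm (\<integral>x. f x \<partial>M) \<le> (\<integral>x. g x \<partial>M)"
  using assms by (intro order_trans[OF integral_norm_bound] integral_mono) auto

text \<open>A bound \<open>G\<close> that is uniform over a ball lets the mean value inequality
  dominate all difference quotients by one integrable function. Measurability of the derivative is
  asked at \<open>x\<close> alone, because \<open>F\<close> is integrated only there; on the rest of
  the ball it serves as a bound.\<close>

lemma has_derivative_lebesgue_integral:
  fixes f :: "'a::real_normed_vector \<Rightarrow> 'b \<Rightarrow> 'c::{banach, second_countable_topology}"
  assumes int: "\<And>y. integrable M (f y)"
    and der: "\<And>y t. y \<in> ball x r \<Longrightarrow> ((\<lambda>y. f y t) has_derivative F y t) (at y)"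
    and bound: "\<And>y t h. y \<in> ball x r \<Longrightarrow> norm (F y t h) \<le> G t * norm h"
    and meas: "\<And>h. (\<lambda>t. F x t h) \<in> borel_measurable M"
    and G: "integrable M G"
    and r: "r > 0"
  shows "((\<lambda>y. \<integral>t. f y t \<partial>M) has_derivative (\<lambda>h. \<integral>t. F x t h \<partial>M)) (at x)"
proof -
  have x: "x \<in> ball x r"
    using r by simp
  \<comment> \<open>In the zero space \<open>bound\<close> says nothing about the sign of
    \<open>G t\<close>, so nonnegativity is stated for the product; \<open>0 \<le> G t\<close>
    follows later from the nonzero \<open>h k\<close>.\<close>
  have G0: "0 \<le> G t * norm h" for t and h :: 'a
    by (rule order_trans[OF norm_ge_zero bound[OF x]])
  have lin: "bounded_linear (F x t)" for t
    using der[OF x] by (rule has_derivative_bounded_linear)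
  have intF: "integrable M (\<lambda>t. F x t h)" for h
  proof (rule Bochner_Integration.integrable_bound)
    show "integrable M (\<lambda>t. G t * norm h)"
      using G by simp
    show "AE t in M. norm (F x t h) \<le> norm (G t * norm h)"
      using bound[OF x] G0 by (auto intro!: AE_I2)
  qed (rule meas)
  have "bounded_linear (\<lambda>h. \<integral>t. F x t h \<partial>M)"
  proof (rule bounded_linear_intro)
    fix h
    have "norm (\<integral>t. F x t h \<partial>M) \<le> (\<integral>t. G t * norm h \<partial>M)"
      using G bound[OF x] by (intro norm_lebesgue_integral_le intF integrable_mult_left) auto
    then show "norm (\<integral>t. F x t h \<partial>M) \<le> norm h * (\<integral>t. G t \<partial>M)"
      by (simp add: mult.commute)
  qed (simp_all add: intF linear_add[OF bounded_linear.linear[OF lin]]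
      linear_scale[OF bounded_linear.linear[OF lin]])
  moreover have "((\<lambda>h. norm ((\<integral>t. f (x + h) t \<partial>M) - (\<integral>t. f x t \<partial>M) - (\<integral>t. F x t h \<partial>M)) / norm h) \<longlongrightarrow> 0) (at 0)"
    unfolding tendsto_at_iff_sequentially comp_def
  proof (intro allI impI)
    fix h :: "nat \<Rightarrow> 'a"
    assume h0: "\<forall>k. h k \<in> UNIV - {0}" and lim: "h \<longlonglongrightarrow> 0"
    \<comment> \<open>The scaled remainder is kept as a vector rather than as its norm, so that its
      integral is the scaled remainder of the integrals.\<close>
    define q where "q k t = (1 / norm (h k)) *\<^sub>R (f (x + h k) t - f x t - F x t (h k))" for k t
    have qmeas: "q k \<in> borel_measurable M" for k
      unfolding q_def using int[THEN borel_measurable_integrable] meas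
      by measurable
    have qlim: "(\<lambda>k. q k t) \<longlonglongrightarrow> 0" for t
    proof -
      have "((\<lambda>h. norm (f (x + h) t - f x t - F x t h) / norm h) \<longlongrightarrow> 0) (at 0)"
        using der[OF x, of t] by (simp add: has_derivative_at)
      then have "(\<lambda>k. norm (f (x + h k) t - f x t - F x t (h k)) / norm (h k)) \<longlonglongrightarrow> 0"
        using h0 lim unfolding tendsto_at_iff_sequentially comp_def by blast
      then show ?thesis
        by (intro tendsto_norm_zero_cancel[of "\<lambda>k. q k t"]) (simp add: q_def)
    qed
    have qbound: "norm (q k t) \<le> 2 * G t" if k: "norm (h k) < r" for k t
    proof -
      \<comment> \<open>The increment contributes one \<open>G t\<close> by the mean value
        inequality on the convex ball, the linear term at \<open>x\<close> another: hence the
        2.\<close>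
      have "norm (f (x + h k) t - f x t) \<le> G t * norm (x + h k - x)"
      proof (rule differentiable_bound[of "ball x r" "\<lambda>y. f y t" "\<lambda>y. F y t"])
        show "onorm (F y t) \<le> G t" if "y \<in> ball x r" for y
        proof -
          have "0 \<le> G t" using G0[of t "h k"] h0 by (simp add: zero_le_mult_iff)
          then show ?thesis using bound[OF that] by (rule onorm_bound)
        qed
      qed (use k r der in \<open>auto simp: dist_norm intro: has_derivative_at_withinI\<close>)
      then have "norm (f (x + h k) t - f x t - F x t (h k)) \<le> 2 * G t * norm (h k)"
        using bound[OF x, of t "h k"] norm_triangle_ineq4[of "f (x + h k) t - f x t" "F x t (h k)"] by simp
      then show ?thesis
        using h0 by (simp add: q_def divide_le_eq)
    qed
    \<comment> \<open>The domination holds only once \<open>x + h k\<close> lies in the ball, so the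
      sequence is shifted by \<open>N\<close> and the shift undone afterwards.\<close>
    obtain N where N: "\<And>k. k \<ge> N \<Longrightarrow> norm (h k) < r"
      using LIMSEQ_D[OF lim r] by auto
    have "(\<lambda>k. \<integral>t. q (k + N) t \<partial>M) \<longlonglongrightarrow> (\<integral>t. 0 \<partial>M)"
    proof (rule integral_dominated_convergence)
      show "integrable M (\<lambda>t. 2 * G t)" using G by simp
      show "AE t in M. (\<lambda>k. q (k + N) t) \<longlonglongrightarrow> 0"
        using qlim by (intro AE_I2 LIMSEQ_ignore_initial_segment)
      show "AE t in M. norm (q (k + N) t) \<le> 2 * G t" for k
        using N by (intro AE_I2 qbound) simp
    qed (auto intro: qmeas)
    then have "(\<lambda>k. \<integral>t. q k t \<partial>M) \<longlonglongrightarrow> 0"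
      by (simp add: LIMSEQ_offset)
    then have "(\<lambda>k. norm (\<integral>t. q k t \<partial>M)) \<longlonglongrightarrow> 0"
      by (rule tendsto_norm_zero)
    then show "(\<lambda>k. norm ((\<integral>t. f (x + h k) t \<partial>M) - (\<integral>t. f x t \<partial>M) - (\<integral>t. F x t (h k) \<partial>M)) / norm (h k)) \<longlonglongrightarrow> 0"
      using int intF by (simp add: q_def)
  qed
  ultimately show ?thesis
    unfolding has_derivative_at by blast
qed

section \<open>Componentwise norms and derivatives for vectors of vectors\<close>

lemma norm_le_sum_norm_nth: "norm x \<le> (\<Sum>i\<in>UNIV. norm (x $ i))"
  by (simp add: norm_vec_def L2_set_le_sum)

lemma norm_le_scaled_componentwise:
  assumes "\<And>i. norm (x $ i) \<le> k * norm (y $ i)" "0 \<le> k"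
  shows "norm x \<le> k * norm y"
proof -
  have "norm x \<le> norm (k *\<^sub>R y)"
    using assms by (intro norm_le_componentwise_cart) simp
  then show ?thesis
    using assms by simp
qed

text \<open>Differentiability can be tested on inner products with basis vectors, and each basis
  vector \<open>axis i b\<close> sees only the component \<open>i\<close>.\<close>

lemma has_derivative_vec_lambda:
  fixes f :: "'a::real_normed_vector \<Rightarrow> 'n::finite \<Rightarrow> 'b::euclidean_space"
  assumes "\<And>i. ((\<lambda>x. f x i) has_derivative (\<lambda>h. f' h i)) (at x)"
  shows "((\<lambda>x. \<chi> i. f x i) has_derivative (\<lambda>h. \<chi> i. f' h i)) (at x)"
  unfolding has_derivative_componentwise_within[where f = "\<lambda>x. \<chi> i. f x i"]
  by (auto simp: Basis_vec_def inner_axis intro!: has_derivative_inner_left assms)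

section \<open>Responsibilities and score at a fixed point\<close>

text \<open>Posterior weight of component \<open>i\<close> given \<open>x\<close>, the gradient in the means of
  \<open>- ln (mixture \<mu> v x)\<close>, and its Hessian applied to \<open>h\<close>.\<close>

definition resp :: "('n \<Rightarrow> real) \<Rightarrow> (real ^ 'd) ^ 'n \<Rightarrow> real ^ 'd \<Rightarrow> 'n \<Rightarrow> real" where
  "resp v \<mu> x i = v i * gauss_density (\<mu> $ i) x / mixture \<mu> v x"

definition score :: "('n \<Rightarrow> real) \<Rightarrow> (real ^ 'd) ^ 'n \<Rightarrow> real ^ 'd \<Rightarrow> (real ^ 'd) ^ 'n" where
  "score v \<mu> x = (\<chi> i. resp v \<mu> x i *\<^sub>R (\<mu> $ i - x))"

definition score_deriv ::
  "('n \<Rightarrow> real) \<Rightarrow> (real ^ 'd) ^ 'n \<Rightarrow> real ^ 'd \<Rightarrow> (real ^ 'd) ^ 'n \<Rightarrow> (real ^ 'd) ^ 'n" where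
  "score_deriv v \<mu> x h = (\<chi> i. resp v \<mu> x i *\<^sub>R
     (h $ i + (score v \<mu> x \<bullet> h - (\<mu> $ i - x) \<bullet> h $ i) *\<^sub>R (\<mu> $ i - x)))"

lemma resp_nonneg:
  assumes "\<And>i. v i > 0"
  shows "0 \<le> resp v \<mu> x i"
  using assms mixture_pos[of v \<mu> x] by (simp add: resp_def gauss_density_pos less_imp_le)

lemma sum_resp:
  assumes "\<And>i. v i > 0"
  shows "(\<Sum>i\<in>UNIV. resp v \<mu> x i) = 1"
  using mixture_pos[of v \<mu> x] assms
  by (simp add: resp_def mixture_def sum_divide_distrib[symmetric] less_imp_neq[symmetric])

lemma resp_le_1:
  assumes "\<And>i. v i > 0"
  shows "resp v \<mu> x i \<le> 1"
  using member_le_sum[of i UNIV "resp v \<mu> x"] sum_resp[of v \<mu> x] resp_nonneg[of v \<mu> x] assms by simp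

text \<open>Serves measurability: the score and its derivative are continuous in \<open>x\<close>,
  since the denominator never vanishes.\<close>

lemma continuous_on_resp [continuous_intros]:
  assumes "\<And>i. v i > 0"
  shows "continuous_on A (\<lambda>x. resp v \<mu> x i)"
  unfolding resp_def using mixture_pos[of v \<mu>] assms
  by (auto simp: mixture_def gauss_density_def less_imp_neq[symmetric] intro!: continuous_intros)

lemma score_measurable:
  assumes "\<And>i. v i > 0"
  shows "score v \<mu> \<in> borel_measurable borel"
  unfolding score_def using assms
  by (intro borel_measurable_continuous_onI continuous_intros)

lemma score_deriv_measurable:
  assumes "\<And>i. v i > 0"
  shows "(\<lambda>x. score_deriv v \<mu> x h) \<in> borel_measurable borel"
  unfolding score_def score_deriv_def using assms
  by (intro borel_measurable_continuous_onI continuous_intros)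

section \<open>Derivatives in the means\<close>

text \<open>Identifies \<open>score v \<mu> x \<bullet> h\<close> with the average \<open>a\<close>
  of the \<open>s\<^sub>i\<close>.\<close>

lemma score_inner:
  "score v \<mu> x \<bullet> h = (\<Sum>i\<in>UNIV. resp v \<mu> x i * ((\<mu> $ i - x) \<bullet> h $ i))"
  by (subst inner_vec_def) (simp add: score_def)

lemma has_derivative_gauss_density:
  "((\<lambda>\<mu>. gauss_density (\<mu> $ i) x) has_derivative
     (\<lambda>h. - gauss_density (\<mu> $ i) x * ((\<mu> $ i - x) \<bullet> h $ i))) (at \<mu>)"
  unfolding gauss_density_def power2_norm_eq_inner
  by (auto intro!: derivative_eq_intros bounded_linear.has_derivative[OF bounded_linear_vec_nth]
      simp: inner_diff_left inner_diff_right inner_commute field_simps fun_eq_iff)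

text \<open>Written as a logarithmic derivative, so that the mixture cancels when the logarithm or a
  quotient is differentiated.\<close>

lemma has_derivative_mixture:
  assumes "\<And>i. v i > 0"
  shows "((\<lambda>\<mu>. mixture \<mu> v x) has_derivative (\<lambda>h. - mixture \<mu> v x * (score v \<mu> x \<bullet> h))) (at \<mu>)"
proof -
  have "((\<lambda>\<mu>. mixture \<mu> v x) has_derivative
      (\<lambda>h. \<Sum>i\<in>UNIV. v i * (- gauss_density (\<mu> $ i) x * ((\<mu> $ i - x) \<bullet> h $ i)))) (at \<mu>)"
    unfolding mixture_def
    by (intro has_derivative_sum has_derivative_mult_right has_derivative_gauss_density)
  moreover have "mixture \<mu> v x * resp v \<mu> x i = v i * gauss_density (\<mu> $ i) x" for i
    using mixture_pos[of v \<mu> x] assms by (simp add: resp_def less_imp_neq[symmetric])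
  then have "mixture \<mu> v x * (score v \<mu> x \<bullet> h) = (\<Sum>i\<in>UNIV. v i * gauss_density (\<mu> $ i) x * ((\<mu> $ i - x) \<bullet> h $ i))" for h
    by (simp add: score_inner sum_distrib_left mult.assoc[symmetric])
  ultimately show ?thesis
    by (simp add: sum_negf[symmetric] mult.assoc)
qed

lemma log_ratio_eq:
  assumes "\<And>l. ws l > 0" "\<And>i. v i > 0"
  shows "log_ratio \<mu>s ws \<mu> v x = ln (mixture \<mu>s ws x) - ln (mixture \<mu> v x)"
  unfolding log_ratio_def by (intro ln_divide_pos mixture_pos assms)

lemma has_derivative_log_ratio:
  assumes "\<And>i. v i > 0" "\<And>l. ws l > 0"
  shows "((\<lambda>\<mu>. log_ratio \<mu>s ws \<mu> v x) has_derivative (\<lambda>h. h \<bullet> score v \<mu> x)) (at \<mu>)"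
proof -
  have pos: "mixture \<mu> v x > 0" for \<mu>
    using assms(1) by (rule mixture_pos)
  have "log_ratio \<mu>s ws \<mu> v x = ln (mixture \<mu>s ws x) - ln (mixture \<mu> v x)" for \<mu>
    using assms by (intro log_ratio_eq)
  moreover have "((\<lambda>\<mu>. ln (mixture \<mu>s ws x) - ln (mixture \<mu> v x)) has_derivative (\<lambda>h. h \<bullet> score v \<mu> x)) (at \<mu>)"
    using pos[of \<mu>]
    by (auto intro!: derivative_eq_intros has_derivative_mixture assms simp: inner_commute field_simps)
  ultimately show ?thesis
    by simp
qed

text \<open>The logarithmic derivative of the numerator is \<open>- s\<^sub>i\<close>, that of the
  denominator \<open>- a\<close>; the quotient has their difference
  \<open>a - s\<^sub>i\<close>.\<close>

lemma has_derivative_resp: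
  assumes "\<And>i. v i > 0"
  shows "((\<lambda>\<mu>. resp v \<mu> x i) has_derivative
    (\<lambda>h. resp v \<mu> x i * (score v \<mu> x \<bullet> h - (\<mu> $ i - x) \<bullet> h $ i))) (at \<mu>)"
  unfolding resp_def using mixture_pos[of v \<mu> x] assms
  by (auto intro!: derivative_eq_intros has_derivative_mixture has_derivative_gauss_density
      simp: field_simps fun_eq_iff)

lemma has_derivative_score:
  assumes "\<And>i. v i > 0"
  shows "((\<lambda>\<mu>. score v \<mu> x) has_derivative score_deriv v \<mu> x) (at \<mu>)"
proof -
  have "((\<lambda>\<mu>. \<chi> i. resp v \<mu> x i *\<^sub>R (\<mu> $ i - x)) has_derivative score_deriv v \<mu> x) (at \<mu>)"
    unfolding score_deriv_def[abs_def]
    by (auto intro!: has_derivative_vec_lambda derivative_eq_intros has_derivative_resp assms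
        bounded_linear.has_derivative[OF bounded_linear_vec_nth]
        simp: scaleR_add_right scaleR_scaleR)
  then show ?thesis
    by (simp add: score_def[abs_def])
qed

section \<open>Pointwise norm bounds\<close>

text \<open>Coefficients dominated by weights of total 1 can be summed without losing a factor
  \<open>n\<close>.\<close>

lemma norm_weighted_vec_le:
  fixes y :: "'n::finite \<Rightarrow> 'a::euclidean_space"
  assumes "\<And>i. \<bar>c i\<bar> \<le> k * g i" "\<And>i. norm (y i) \<le> R" "(\<Sum>i\<in>UNIV. g i) = 1"
  shows "norm (\<chi> i. c i *\<^sub>R y i) \<le> k * R"
proof -
  have "norm (\<chi> i. c i *\<^sub>R y i) \<le> (\<Sum>i\<in>UNIV. norm (c i *\<^sub>R y i))"
    using norm_le_sum_norm_nth[of "\<chi> i. c i *\<^sub>R y i"] by simp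
  also have "\<dots> \<le> (\<Sum>i\<in>UNIV. k * g i * R)"
  proof (rule sum_mono)
    fix i
    have "0 \<le> k * g i"
      using assms(1)[of i] by linarith
    then show "norm (c i *\<^sub>R y i) \<le> k * g i * R"
      using assms by (simp add: mult_mono)
  qed
  also have "\<dots> = k * R"
    using assms(3) by (simp flip: sum_distrib_left sum_distrib_right)
  finally show ?thesis .
qed

text \<open>The first summand is block diagonal: component \<open>i\<close> depends on
  \<open>h $ i\<close> only, so a uniform bound on the coefficients suffices. The second couples the
  components and is handled as a weighted sum; in the applications \<open>\<beta>\<close> contains
  \<open>norm h\<close>.\<close>

lemma norm_weighted_hessian_le:
  fixes y :: "'n::finite \<Rightarrow> 'a::euclidean_space" and h :: "'a ^ 'n"
  assumes c: "\<And>i. \<bar>c i\<bar> \<le> k" and R: "\<And>i. norm (y i) \<le> R"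
    and b: "\<And>i. \<bar>b i\<bar> \<le> \<beta> * g i" and g: "(\<Sum>i\<in>UNIV. g i) = 1"
  shows "norm (\<chi> i. c i *\<^sub>R (h $ i - (y i \<bullet> h $ i) *\<^sub>R y i) + b i *\<^sub>R y i)
    \<le> k * (1 + R\<^sup>2) * norm h + \<beta> * R"
proof -
  have R0: "0 \<le> R" and k0: "0 \<le> k"
    using order_trans[OF norm_ge_zero R] order_trans[OF abs_ge_zero c] by auto
  define p where "p = (\<chi> i. c i *\<^sub>R (h $ i - (y i \<bullet> h $ i) *\<^sub>R y i))"
  have "norm p \<le> k * (1 + R\<^sup>2) * norm h"
  proof (rule norm_le_scaled_componentwise)
    fix i
    have "\<bar>y i \<bullet> h $ i\<bar> \<le> R * norm (h $ i)"
      by (rule order_trans[OF Cauchy_Schwarz_ineq2 mult_right_mono[OF R norm_ge_zero]])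
    then have "\<bar>y i \<bullet> h $ i\<bar> * norm (y i) \<le> (R * norm (h $ i)) * R"
      using R R0 by (intro mult_mono) auto
    then have "norm (h $ i - (y i \<bullet> h $ i) *\<^sub>R y i) \<le> (1 + R\<^sup>2) * norm (h $ i)"
      by (intro order_trans[OF norm_triangle_ineq4]) (simp add: power2_eq_square algebra_simps)
    then show "norm (p $ i) \<le> k * (1 + R\<^sup>2) * norm (h $ i)"
      using c k0 by (simp add: p_def mult.assoc mult_mono)
  qed (use k0 in simp)
  moreover have "norm (\<chi> i. b i *\<^sub>R y i) \<le> \<beta> * R"
    using b R g by (rule norm_weighted_vec_le)
  moreover have "(\<chi> i. c i *\<^sub>R (h $ i - (y i \<bullet> h $ i) *\<^sub>R y i) + b i *\<^sub>R y i) = p + (\<chi> i. b i *\<^sub>R y i)"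
    by (simp add: p_def vec_eq_iff)
  ultimately show ?thesis
    using norm_triangle_ineq[of p "\<chi> i. b i *\<^sub>R y i"] by simp
qed

lemma norm_score_le:
  assumes v: "\<And>i. v i > 0" and R: "\<And>i. norm (\<mu> $ i - x) \<le> R"
  shows "norm (score v \<mu> x) \<le> R"
  using norm_weighted_vec_le[where c = "resp v \<mu> x" and g = "resp v \<mu> x" and k = 1, OF _ R]
    resp_nonneg[of v \<mu> x] sum_resp[of v \<mu> x] v
  by (simp add: score_def)

lemma abs_score_inner_le:
  assumes v: "\<And>i. v i > 0" and R: "\<And>i. norm (\<mu> $ i - x) \<le> R"
  shows "\<bar>score v \<mu> x \<bullet> h\<bar> \<le> R * norm h"
  by (rule order_trans[OF Cauchy_Schwarz_ineq2 mult_right_mono[OF norm_score_le[OF v R] norm_ge_zero]])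

text \<open>The block diagonal part gives \<open>1 + R\<^sup>2\<close>, the coupling part through
  \<open>a\<close> another \<open>R\<^sup>2\<close>. The bound later dominates the derivative of the
  score.\<close>

lemma norm_score_deriv_le:
  assumes v: "\<And>i. v i > 0" and R: "\<And>i. norm (\<mu> $ i - x) \<le> R"
  shows "norm (score_deriv v \<mu> x h) \<le> (1 + 2 * R\<^sup>2) * norm h"
proof -
  have "\<bar>resp v \<mu> x i * (score v \<mu> x \<bullet> h)\<bar> \<le> R * norm h * resp v \<mu> x i" for i
    using mult_right_mono[OF abs_score_inner_le[of v \<mu> x R h] resp_nonneg[of v \<mu> x i]] v R
      resp_nonneg[of v \<mu> x i]
    by (simp add: abs_mult mult.commute)
  then have "norm (\<chi> i. resp v \<mu> x i *\<^sub>R (h $ i - ((\<mu> $ i - x) \<bullet> h $ i) *\<^sub>R (\<mu> $ i - x))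
      + (resp v \<mu> x i * (score v \<mu> x \<bullet> h)) *\<^sub>R (\<mu> $ i - x)) \<le> 1 * (1 + R\<^sup>2) * norm h + R * norm h * R"
    using R resp_nonneg[of v \<mu> x] resp_le_1[of v \<mu> x] v
    by (intro norm_weighted_hessian_le[where g = "resp v \<mu> x"]) (auto simp: sum_resp)
  then show ?thesis
    by (simp add: score_deriv_def algebra_simps power2_eq_square)
qed

section \<open>Pointwise comparison of two weight vectors\<close>

text \<open>The comparison lemmas assume only closeness with relative error \<open>D\<close>; this
  recovers the sign of \<open>D\<close> from it.\<close>

lemma nonneg_of_mult_pos: "0 \<le> D * a \<Longrightarrow> 0 < a \<Longrightarrow> 0 \<le> D" for a D :: real
  by (simp add: zero_le_mult_iff)

lemma mixture_diff_le:
  assumes close: "\<And>i. \<bar>v i - u i\<bar> \<le> D * u i"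
  shows "\<bar>mixture \<mu> v x - mixture \<mu> u x\<bar> \<le> D * mixture \<mu> u x"
proof -
  have "\<bar>mixture \<mu> v x - mixture \<mu> u x\<bar> \<le> (\<Sum>i\<in>UNIV. \<bar>v i - u i\<bar> * gauss_density (\<mu> $ i) x)"
    unfolding mixture_def sum_subtractf[symmetric] left_diff_distrib[symmetric]
    by (rule order_trans[OF sum_abs]) (simp add: abs_mult gauss_density_pos less_imp_le)
  also have "\<dots> \<le> (\<Sum>i\<in>UNIV. D * u i * gauss_density (\<mu> $ i) x)"
    using close by (intro sum_mono mult_right_mono) (auto simp: gauss_density_pos less_imp_le)
  finally show ?thesis
    by (simp add: mixture_def sum_distrib_left mult.assoc)
qed

text \<open>Here \<open>D \<le> 1 / 2\<close> enters: half of the \<open>u\<close>-mixture survives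
  the error, so either mixture may serve as denominator.\<close>

lemma mixture_half_le:
  assumes "\<And>i. \<bar>v i - u i\<bar> \<le> D * u i" "\<And>i. u i > 0" "D \<le> 1 / 2"
  shows "mixture \<mu> u x \<le> 2 * mixture \<mu> v x"
proof -
  have "D * mixture \<mu> u x \<le> 1 / 2 * mixture \<mu> u x"
    using assms mixture_pos[of u \<mu> x] by (intro mult_right_mono) (auto simp: less_imp_le)
  then show ?thesis
    using mixture_diff_le[of v u D \<mu> x] assms(1) by (auto simp: abs_le_iff)
qed

text \<open>From \<open>ln p - ln q \<le> (p - q) / q\<close>, used in both directions. The
  direction with denominator \<open>p\<close> costs the factor 2.\<close>

lemma ln_mixture_diff_le:
  assumes close: "\<And>i. \<bar>v i - u i\<bar> \<le> D * u i" and pos: "\<And>i. v i > 0" "\<And>i. u i > 0" and D: "D \<le> 1 / 2"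
  shows "\<bar>ln (mixture \<mu> v x) - ln (mixture \<mu> u x)\<bar> \<le> 2 * D"
proof -
  define p q where "p = mixture \<mu> v x" and "q = mixture \<mu> u x"
  have p: "p > 0" and q: "q > 0"
    unfolding p_def q_def by (rule mixture_pos pos)+
  have diff: "\<bar>p - q\<bar> \<le> D * q"
    unfolding p_def q_def using close by (rule mixture_diff_le)
  then have D0: "0 \<le> D"
    using q order_trans[OF abs_ge_zero] by (metis nonneg_of_mult_pos)
  have half: "q \<le> 2 * p"
    unfolding p_def q_def using close pos(2) D by (rule mixture_half_le)
  have "ln p - ln q \<le> (p - q) / q"
    using ln_diff_le[OF p q] .
  also have "\<dots> \<le> 2 * D"
    using diff q D0 by (simp add: divide_le_eq abs_le_iff)
  finally have 1: "ln p - ln q \<le> 2 * D" .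
  have "ln q - ln p \<le> (q - p) / p"
    using ln_diff_le[OF q p] .
  also have "\<dots> \<le> 2 * D"
    using diff p mult_left_mono[OF half D0] by (simp add: divide_le_eq abs_le_iff)
  finally show ?thesis
    using 1 by (simp add: p_def q_def abs_le_iff)
qed

text \<open>Numerator and denominator each contribute a relative error \<open>D\<close>, and
  replacing the denominator \<open>q\<close> by \<open>2 * p\<close> doubles the sum: hence
  \<open>4 * D\<close>.\<close>

lemma resp_diff_le:
  assumes close: "\<And>i. \<bar>v i - u i\<bar> \<le> D * u i" and pos: "\<And>i. v i > 0" "\<And>i. u i > 0" and D: "D \<le> 1 / 2"
  shows "\<bar>resp v \<mu> x i - resp u \<mu> x i\<bar> \<le> 4 * D * resp u \<mu> x i"
proof -
  define p q g where "p = mixture \<mu> v x" and "q = mixture \<mu> u x" and "g = gauss_density (\<mu> $ i) x"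
  have p: "p > 0" and q: "q > 0" and g: "g > 0"
    unfolding p_def q_def g_def by (rule mixture_pos pos gauss_density_pos)+
  have diff: "\<bar>p - q\<bar> \<le> D * q"
    unfolding p_def q_def using close by (rule mixture_diff_le)
  then have D0: "0 \<le> D"
    using q order_trans[OF abs_ge_zero] by (metis nonneg_of_mult_pos)
  have half: "q \<le> 2 * p"
    unfolding p_def q_def using close pos(2) D by (rule mixture_half_le)
  \<comment> \<open>Inserting \<open>u i * q\<close> separates the error of the weight from that of
    the mixture.\<close>
  have "\<bar>v i * q - u i * p\<bar> = \<bar>(v i - u i) * q - u i * (p - q)\<bar>"
    by (simp add: algebra_simps)
  also have "\<dots> \<le> \<bar>v i - u i\<bar> * q + u i * \<bar>p - q\<bar>"
    using q pos(2)[of i] by (intro order_trans[OF abs_triangle_ineq4]) (simp add: abs_mult)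
  also have "\<dots> \<le> (D * u i) * q + u i * (D * q)"
    using close q pos(2)[of i] diff D0 by (intro add_mono mult_mono) auto
  also have "\<dots> = (2 * D * u i) * q"
    by simp
  also have "\<dots> \<le> (2 * D * u i) * (2 * p)"
    using half D0 pos(2)[of i] by (intro mult_left_mono) auto
  finally have bound: "\<bar>v i * q - u i * p\<bar> * g \<le> 4 * D * u i * p * g"
    using g by simp
  have "\<bar>resp v \<mu> x i - resp u \<mu> x i\<bar> = \<bar>(v i * q - u i * p) * g / (p * q)\<bar>"
    using p q by (simp add: resp_def p_def[symmetric] q_def[symmetric] g_def[symmetric] field_simps)
  also have "\<dots> = \<bar>v i * q - u i * p\<bar> * g / (p * q)"
    using p q g by (simp add: abs_mult)
  also have "\<dots> \<le> 4 * D * u i * p * g / (p * q)"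
    using p q bound by (intro divide_right_mono) auto
  also have "\<dots> = 4 * D * resp u \<mu> x i"
    using p q by (simp add: resp_def q_def[symmetric] g_def[symmetric])
  finally show ?thesis .
qed

lemma score_diff:
  "score v \<mu> x - score u \<mu> x = (\<chi> i. (resp v \<mu> x i - resp u \<mu> x i) *\<^sub>R (\<mu> $ i - x))"
  by (simp add: score_def vec_eq_iff algebra_simps)

lemma norm_score_diff_le:
  assumes close: "\<And>i. \<bar>resp v \<mu> x i - resp u \<mu> x i\<bar> \<le> k * resp u \<mu> x i"
    and u: "\<And>i. u i > 0" and R: "\<And>i. norm (\<mu> $ i - x) \<le> R"
  shows "norm (score v \<mu> x - score u \<mu> x) \<le> k * R"
  unfolding score_diff using close R sum_resp[OF u] by (rule norm_weighted_vec_le)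

text \<open>The block diagonal part contributes \<open>k * (1 + R\<^sup>2)\<close>. The coupling
  coefficient is a product of responsibility and average, both of which change; each change
  contributes \<open>k * R\<^sup>2\<close>.\<close>

lemma norm_score_deriv_diff_le:
  assumes close: "\<And>i. \<bar>resp v \<mu> x i - resp u \<mu> x i\<bar> \<le> k * resp u \<mu> x i"
    and v: "\<And>i. v i > 0" and u: "\<And>i. u i > 0" and R: "\<And>i. norm (\<mu> $ i - x) \<le> R" and k: "0 \<le> k"
  shows "norm (score_deriv v \<mu> x h - score_deriv u \<mu> x h) \<le> k * (1 + 3 * R\<^sup>2) * norm h"
proof -
  let ?d = "\<lambda>i. resp v \<mu> x i - resp u \<mu> x i"
  let ?a = "score v \<mu> x \<bullet> h" and ?a' = "score u \<mu> x \<bullet> h"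
  have R0: "0 \<le> R"
    using order_trans[OF norm_ge_zero R] .
  have nn: "0 \<le> resp u \<mu> x i" for i
    using u by (rule resp_nonneg)
  have a: "\<bar>?a\<bar> \<le> R * norm h"
    using v R by (rule abs_score_inner_le)
  have "\<bar>(score v \<mu> x - score u \<mu> x) \<bullet> h\<bar> \<le> k * R * norm h"
    by (rule order_trans[OF Cauchy_Schwarz_ineq2 mult_right_mono[OF norm_score_diff_le[OF close u R] norm_ge_zero]])
  then have da: "\<bar>?a - ?a'\<bar> \<le> k * R * norm h"
    by (simp add: inner_diff_left)
  have d: "\<bar>?d i\<bar> \<le> k" for i
    using close[of i] mult_left_mono[OF resp_le_1[of u \<mu> x i, OF u] k] by simp
  \<comment> \<open>The product rule for differences: change of the responsibility times the new
    average, plus old responsibility times the change of the average. Both are proportional to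
    \<open>resp u \<mu> x i\<close>, as the weighted sum requires.\<close>
  have b: "\<bar>?d i * ?a + resp u \<mu> x i * (?a - ?a')\<bar> \<le> 2 * k * R * norm h * resp u \<mu> x i" for i
  proof -
    have "\<bar>?d i * ?a\<bar> \<le> (k * resp u \<mu> x i) * (R * norm h)"
      unfolding abs_mult using close a k nn by (intro mult_mono) auto
    moreover have "\<bar>resp u \<mu> x i * (?a - ?a')\<bar> \<le> resp u \<mu> x i * (k * R * norm h)"
      unfolding abs_mult using da nn[of i] by (intro mult_mono) auto
    ultimately show ?thesis
      using abs_triangle_ineq[of "?d i * ?a" "resp u \<mu> x i * (?a - ?a')"] by (simp add: mult_ac)
  qed
  have "score_deriv v \<mu> x h - score_deriv u \<mu> x h =
    (\<chi> i. ?d i *\<^sub>R (h $ i - ((\<mu> $ i - x) \<bullet> h $ i) *\<^sub>R (\<mu> $ i - x))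
      + (?d i * ?a + resp u \<mu> x i * (?a - ?a')) *\<^sub>R (\<mu> $ i - x))"
    by (simp add: score_deriv_def vec_eq_iff algebra_simps)
  also have "norm \<dots> \<le> k * (1 + R\<^sup>2) * norm h + 2 * k * R * norm h * R"
    using d R b sum_resp[OF u] by (rule norm_weighted_hessian_le)
  finally show ?thesis
    by (simp add: algebra_simps power2_eq_square)
qed

section \<open>The population loss: integrability, gradient and Hessian\<close>

text \<open>Above, every component is bounded by the Gaussian peak \<open>k\<close>; below, the
  mixture exceeds any single component. So the logarithm grows at most quadratically.\<close>

lemma abs_ln_mixture_le:
  fixes \<mu> :: "(real ^ 'd) ^ 'n"
  assumes v: "\<And>i. v i > 0"
  defines "k \<equiv> (2 * pi) powr (- real CARD('d) / 2)"
  shows "\<bar>ln (mixture \<mu> v x)\<bar> \<le> \<bar>ln (v i * k)\<bar> + \<bar>ln ((\<Sum>j\<in>UNIV. v j) * k)\<bar> + (norm (x - \<mu> $ i))\<^sup>2 / 2"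
proof -
  have k: "k > 0"
    by (simp add: k_def)
  have V: "(\<Sum>j\<in>UNIV. v j) > 0"
    using v by (intro sum_pos) auto
  have p: "mixture \<mu> v x > 0"
    using v by (rule mixture_pos)
  have "mixture \<mu> v x \<le> (\<Sum>j\<in>UNIV. v j * k)"
    unfolding mixture_def k_def using v
    by (intro sum_mono mult_left_mono gauss_density_le) (simp add: less_imp_le)
  then have up: "ln (mixture \<mu> v x) \<le> ln ((\<Sum>j\<in>UNIV. v j) * k)"
    using p V k by (simp add: sum_distrib_right)
  have "v i * k * exp (- (norm (x - \<mu> $ i))\<^sup>2 / 2) \<le> mixture \<mu> v x"
    using member_le_sum[of i UNIV "\<lambda>j. v j * gauss_density (\<mu> $ j) x"] v
    by (simp add: mixture_def k_def gauss_density_def less_imp_le mult.assoc)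
  then have "ln (v i * k * exp (- (norm (x - \<mu> $ i))\<^sup>2 / 2)) \<le> ln (mixture \<mu> v x)"
    using p v k by simp
  then have "ln (v i * k) - (norm (x - \<mu> $ i))\<^sup>2 / 2 \<le> ln (mixture \<mu> v x)"
    using v[of i] k by (simp add: ln_mult)
  with up zero_le_power2[of "norm (x - \<mu> $ i)"] show ?thesis
    by linarith
qed

locale mixture_model =
  fixes \<mu>s :: "(real ^ 'd) ^ 'm" and ws :: "'m \<Rightarrow> real"
  assumes ws_pos: "\<And>l. ws l > 0" and ws_simplex: "ws \<in> prob_simplex"
begin

abbreviation P :: "(real ^ 'd) measure" where
  "P \<equiv> mixture_measure \<mu>s ws"

sublocale prob_space P
  using ws_simplex by (rule prob_space_mixture_measure)

lemma prob_UNIV: "prob UNIV = 1"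
  using prob_space by simp

lemma integrable_norm_sq [simp]: "integrable P (\<lambda>x. (norm x)\<^sup>2)"
  using ws_pos by (rule integrable_mixture_measure_sq)

text \<open>With \<open>c = norm \<mu> + 1\<close>, the function \<open>norm x + c\<close> will
  dominate the score on the unit ball around \<open>\<mu>\<close>, and its square will control the
  derivative of the score.\<close>

lemma integrable_norm_affine_sq: "integrable P (\<lambda>x. (norm x + c)\<^sup>2)"
proof (rule Bochner_Integration.integrable_bound)
  show "integrable P (\<lambda>x. 2 * ((norm x)\<^sup>2 + c\<^sup>2))"
    by simp
  show "AE x in P. norm ((norm x + c)\<^sup>2) \<le> norm (2 * ((norm x)\<^sup>2 + c\<^sup>2))"
    using norm_diff_sq_le[of "norm _" "- c"] by (intro AE_I2) simp
qed measurable

lemma integrable_norm_affine: "integrable P (\<lambda>x. norm x + c)"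
  using integrable_norm_affine_sq[of c] by (rule square_integrable_imp_integrable[rotated]) measurable

lemma integrable_ln_mixture:
  assumes v: "\<And>i. v i > 0"
  shows "integrable P (\<lambda>x. ln (mixture \<mu> v x))"
proof (rule Bochner_Integration.integrable_bound)
  \<comment> \<open>Any one component will do for the lower bound; index types are nonempty.\<close>
  fix i
  let ?k = "(2 * pi) powr (- real CARD('d) / 2)"
  let ?c = "\<bar>ln (v i * ?k)\<bar> + \<bar>ln ((\<Sum>j\<in>UNIV. v j) * ?k)\<bar> + (norm (\<mu> $ i))\<^sup>2"
  show "integrable P (\<lambda>x. ?c + (norm x)\<^sup>2)"
    by simp
  show "AE x in P. norm (ln (mixture \<mu> v x)) \<le> norm (?c + (norm x)\<^sup>2)"
  proof (rule AE_I2)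
    fix x
    show "norm (ln (mixture \<mu> v x)) \<le> norm (?c + (norm x)\<^sup>2)"
      using abs_ln_mixture_le[of v \<mu> x i, OF v] norm_diff_sq_le[of x "\<mu> $ i"] by simp
  qed
qed measurable

lemma integrable_log_ratio:
  assumes "\<And>i. v i > 0"
  shows "integrable P (log_ratio \<mu>s ws \<mu> v)"
proof -
  have "integrable P (\<lambda>x. ln (mixture \<mu>s ws x) - ln (mixture \<mu> v x))"
    by (intro Bochner_Integration.integrable_diff integrable_ln_mixture ws_pos assms)
  moreover have "log_ratio \<mu>s ws \<mu> v = (\<lambda>x. ln (mixture \<mu>s ws x) - ln (mixture \<mu> v x))"
    using ws_pos assms by (intro ext log_ratio_eq)
  ultimately show ?thesis
    by simp
qed

text \<open>Uniform in \<open>y\<close> over the unit ball, as differentiation under the integral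
  needs.\<close>

lemma norm_mean_diff_le:
  fixes \<mu> y :: "(real ^ 'd) ^ 'n"
  assumes "y \<in> ball \<mu> 1"
  shows "norm (y $ i - x) \<le> norm x + (norm \<mu> + 1)"
proof -
  have "norm (y - \<mu>) < 1"
    using assms by (simp add: dist_norm norm_minus_commute)
  moreover have "norm (y $ i) \<le> norm y"
    by (rule Finite_Cartesian_Product.norm_nth_le)
  ultimately have "norm (y $ i) \<le> norm \<mu> + 1"
    using norm_triangle_ineq2[of y \<mu>] by linarith
  then show ?thesis
    using norm_triangle_ineq4[of "y $ i" x] by linarith
qed

lemma integrable_score:
  assumes v: "\<And>i. v i > 0"
  shows "integrable P (score v \<mu>)"
proof (rule Bochner_Integration.integrable_bound)
  show "integrable P (\<lambda>x. norm x + (norm \<mu> + 1))"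
    by (rule integrable_norm_affine)
  show "AE x in P. norm (score v \<mu> x) \<le> norm (norm x + (norm \<mu> + 1))"
    using norm_score_le[OF v norm_mean_diff_le[of \<mu> \<mu>]] by (intro AE_I2) (simp add: order_trans[OF _ abs_ge_self])
qed (use score_measurable[OF v] in measurable)

lemma integrable_score_deriv:
  assumes v: "\<And>i. v i > 0"
  shows "integrable P (\<lambda>x. score_deriv v \<mu> x h)"
proof (rule Bochner_Integration.integrable_bound)
  show "integrable P (\<lambda>x. (1 + 2 * (norm x + (norm \<mu> + 1))\<^sup>2) * norm h)"
    by (intro integrable_mult_left Bochner_Integration.integrable_add integrable_mult_right integrable_norm_affine_sq) simp
  show "AE x in P. norm (score_deriv v \<mu> x h) \<le> norm ((1 + 2 * (norm x + (norm \<mu> + 1))\<^sup>2) * norm h)"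
    using norm_score_deriv_le[OF v norm_mean_diff_le[of \<mu> \<mu>]]
    by (intro AE_I2) (simp add: order_trans[OF _ abs_ge_self])
qed (use score_deriv_measurable[OF v] in measurable)

lemma has_derivative_pop_loss:
  assumes v: "\<And>i. v i > 0"
  shows "((\<lambda>\<mu>. pop_loss \<mu>s ws \<mu> v) has_derivative (\<lambda>h. h \<bullet> (\<integral>x. score v \<mu> x \<partial>P))) (at \<mu>)"
proof -
  have "((\<lambda>\<mu>. pop_loss \<mu>s ws \<mu> v) has_derivative (\<lambda>h. \<integral>x. h \<bullet> score v \<mu> x \<partial>P)) (at \<mu>)"
    unfolding pop_loss_def
  proof (rule has_derivative_lebesgue_integral[where r = 1])
    show "integrable P (\<lambda>x. norm x + (norm \<mu> + 1))"
      by (rule integrable_norm_affine)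
    show "norm (h \<bullet> score v y x) \<le> (norm x + (norm \<mu> + 1)) * norm h" if "y \<in> ball \<mu> 1" for y x h
      using abs_score_inner_le[OF v norm_mean_diff_le[OF that]] by (simp add: inner_commute)
    show "(\<lambda>x. h \<bullet> score v \<mu> x) \<in> borel_measurable P" for h
      using score_measurable[OF v] by measurable
  qed (auto intro!: integrable_log_ratio has_derivative_log_ratio v ws_pos)
  then show ?thesis
    by (simp add: integrable_score v)
qed

text \<open>Uniqueness of the Frechet derivative resolves the definite description in
  \<open>grad\<close>.\<close>

lemma grad_pop_loss:
  assumes v: "\<And>i. v i > 0"
  shows "grad (\<lambda>\<mu>. pop_loss \<mu>s ws \<mu> v) \<mu> = (\<integral>x. score v \<mu> x \<partial>P)"
  unfolding grad_def
proof (rule the_equality)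
  show "GDERIV (\<lambda>\<mu>. pop_loss \<mu>s ws \<mu> v) \<mu> :> (\<integral>x. score v \<mu> x \<partial>P)"
    unfolding gderiv_def using v by (rule has_derivative_pop_loss)
  fix D
  assume "GDERIV (\<lambda>\<mu>. pop_loss \<mu>s ws \<mu> v) \<mu> :> D"
  then have "(\<lambda>h. h \<bullet> D) = (\<lambda>h. h \<bullet> (\<integral>x. score v \<mu> x \<partial>P))"
    unfolding gderiv_def using has_derivative_pop_loss[OF v] by (rule has_derivative_unique)
  then have "h \<bullet> D = h \<bullet> (\<integral>x. score v \<mu> x \<partial>P)" for h
    by (rule fun_cong)
  then show "D = (\<integral>x. score v \<mu> x \<partial>P)"
    by (metis vector_eq_ldot)
qed

lemma has_derivative_grad_pop_loss:
  assumes v: "\<And>i. v i > 0"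
  shows "(grad (\<lambda>\<mu>. pop_loss \<mu>s ws \<mu> v) has_derivative (\<lambda>h. \<integral>x. score_deriv v \<mu> x h \<partial>P)) (at \<mu>)"
proof -
  have "grad (\<lambda>\<mu>. pop_loss \<mu>s ws \<mu> v) = (\<lambda>\<mu>. \<integral>x. score v \<mu> x \<partial>P)"
    using v by (intro ext grad_pop_loss)
  moreover have "((\<lambda>\<mu>. \<integral>x. score v \<mu> x \<partial>P) has_derivative (\<lambda>h. \<integral>x. score_deriv v \<mu> x h \<partial>P)) (at \<mu>)"
  proof (rule has_derivative_lebesgue_integral[where r = 1])
    show "integrable P (\<lambda>x. 1 + 2 * (norm x + (norm \<mu> + 1))\<^sup>2)"
      by (intro Bochner_Integration.integrable_add integrable_mult_right integrable_norm_affine_sq) simp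
    show "norm (score_deriv v y x h) \<le> (1 + 2 * (norm x + (norm \<mu> + 1))\<^sup>2) * norm h" if "y \<in> ball \<mu> 1" for y x h
      using v norm_mean_diff_le[OF that] by (rule norm_score_deriv_le)
    show "(\<lambda>x. score_deriv v \<mu> x h) \<in> borel_measurable P" for h
      using score_deriv_measurable[OF v] by measurable
  qed (auto intro!: integrable_score has_derivative_score v)
  ultimately show ?thesis
    by simp
qed

lemma hess_pop_loss:
  assumes v: "\<And>i. v i > 0"
  shows "hess (\<lambda>\<mu>. pop_loss \<mu>s ws \<mu> v) \<mu> h = (\<integral>x. score_deriv v \<mu> x h \<partial>P)"
  unfolding hess_def frechet_derivative_at[OF has_derivative_grad_pop_loss[OF v], symmetric] ..

section \<open>Integrated comparison of the losses\<close>

text \<open>The log density of the true mixture cancels, and the uniform bound on the remaining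
  logarithms is integrated against total mass 1.\<close>

lemma pop_loss_diff_le:
  assumes close: "\<And>i. \<bar>v i - u i\<bar> \<le> D * u i" and v: "\<And>i. v i > 0" and u: "\<And>i. u i > 0" and D: "D \<le> 1 / 2"
  shows "\<bar>pop_loss \<mu>s ws \<mu> v - pop_loss \<mu>s ws \<mu> u\<bar> \<le> 2 * D"
proof -
  have "pop_loss \<mu>s ws \<mu> v - pop_loss \<mu>s ws \<mu> u = (\<integral>x. log_ratio \<mu>s ws \<mu> v x - log_ratio \<mu>s ws \<mu> u x \<partial>P)"
    unfolding pop_loss_def
    by (intro Bochner_Integration.integral_diff[symmetric] integrable_log_ratio v u)
  also have "\<bar>\<dots>\<bar> \<le> (\<integral>x. 2 * D \<partial>P)"
    unfolding real_norm_def[symmetric]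
  proof (rule norm_lebesgue_integral_le)
    show "norm (log_ratio \<mu>s ws \<mu> v x - log_ratio \<mu>s ws \<mu> u x) \<le> 2 * D" for x
      using ln_mixture_diff_le[of v u D \<mu> x] close v u D ws_pos by (simp add: log_ratio_eq)
  qed (auto intro!: integrable_log_ratio v u)
  finally show ?thesis
    by (simp add: prob_UNIV)
qed

text \<open>The pointwise error is linear in \<open>R\<close>, but only \<open>R\<^sup>2\<close> has
  an explicit expectation; this is where the square root comes from.\<close>

lemma grad_pop_loss_diff_le:
  assumes close: "\<And>i. \<bar>v i - u i\<bar> \<le> D * u i" and v: "\<And>i. v i > 0" and u: "\<And>i. u i > 0" and D: "D \<le> 1 / 2"
    and M: "\<And>i. norm (\<mu> $ i) \<le> M"
  shows "norm (grad (\<lambda>\<mu>. pop_loss \<mu>s ws \<mu> v) \<mu> - grad (\<lambda>\<mu>. pop_loss \<mu>s ws \<mu> u) \<mu>)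
    \<le> 4 * D * sqrt (2 * (second_moment \<mu>s ws + M\<^sup>2))"
proof -
  define R where "R x = sqrt (2 * ((norm x)\<^sup>2 + M\<^sup>2))" for x :: "real ^ 'd"
  have R: "norm (\<mu> $ i - x) \<le> R x" for i x
    unfolding R_def using M by (rule norm_diff_le_sqrt)
  have R2: "(R x)\<^sup>2 = 2 * ((norm x)\<^sup>2 + M\<^sup>2)" for x
    by (simp add: R_def)
  have int_R2: "integrable P (\<lambda>x. (R x)\<^sup>2)"
    by (simp add: R2)
  have int_R: "integrable P R"
    using int_R2 by (rule square_integrable_imp_integrable[rotated]) (simp add: R_def[abs_def])
  have E_R2: "expectation (\<lambda>x. (R x)\<^sup>2) = 2 * (second_moment \<mu>s ws + M\<^sup>2)"
    by (simp add: R2 second_moment_def prob_UNIV)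
  \<comment> \<open>Jensen: \<open>(E R)\<^sup>2 \<le> E R\<^sup>2\<close>\<close>
  have "0 \<le> variance R"
    by (rule integral_nonneg_AE) simp
  then have "(expectation R)\<^sup>2 \<le> expectation (\<lambda>x. (R x)\<^sup>2)"
    using variance_eq[OF int_R int_R2] by simp
  then have E_R: "expectation R \<le> sqrt (2 * (second_moment \<mu>s ws + M\<^sup>2))"
    unfolding E_R2 by (rule real_le_rsqrt)
  have D0: "0 \<le> D"
    using order_trans[OF abs_ge_zero close] u by (rule nonneg_of_mult_pos)
  have "grad (\<lambda>\<mu>. pop_loss \<mu>s ws \<mu> v) \<mu> - grad (\<lambda>\<mu>. pop_loss \<mu>s ws \<mu> u) \<mu> = (\<integral>x. score v \<mu> x - score u \<mu> x \<partial>P)"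
    unfolding grad_pop_loss[OF v] grad_pop_loss[OF u]
    by (intro Bochner_Integration.integral_diff[symmetric] integrable_score v u)
  also have "norm \<dots> \<le> (\<integral>x. 4 * D * R x \<partial>P)"
  proof (rule norm_lebesgue_integral_le)
    show "norm (score v \<mu> x - score u \<mu> x) \<le> 4 * D * R x" for x
      using resp_diff_le[OF close v u D] u R by (rule norm_score_diff_le)
  qed (auto intro!: integrable_score v u int_R)
  also have "\<dots> \<le> 4 * D * sqrt (2 * (second_moment \<mu>s ws + M\<^sup>2))"
    using E_R D0 by (simp add: mult_left_mono)
  finally show ?thesis .
qed

text \<open>The pointwise bound is brought to the form \<open>1 + 2 * R\<^sup>2\<close>, whose
  expectation is exactly the stated factor; the surplus \<open>R\<^sup>2\<close> is absorbed by
  \<open>CARD('n)\<close>.\<close>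

lemma hess_pop_loss_diff_le:
  fixes u v :: "'n::finite \<Rightarrow> real"
  assumes close: "\<And>i. \<bar>v i - u i\<bar> \<le> D * u i" and v: "\<And>i. v i > 0" and u: "\<And>i. u i > 0" and D: "D \<le> 1 / 2"
    and M: "\<And>i. norm (\<mu> $ i) \<le> M"
  shows "norm (hess (\<lambda>\<mu>. pop_loss \<mu>s ws \<mu> v) \<mu> h - hess (\<lambda>\<mu>. pop_loss \<mu>s ws \<mu> u) \<mu> h)
    \<le> 4 * D * real CARD('n) * (1 + 4 * (second_moment \<mu>s ws + M\<^sup>2)) * norm h"
proof -
  define R where "R x = sqrt (2 * ((norm x)\<^sup>2 + M\<^sup>2))" for x :: "real ^ 'd"
  have R: "norm (\<mu> $ i - x) \<le> R x" for i x
    unfolding R_def using M by (rule norm_diff_le_sqrt)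
  have R2: "(R x)\<^sup>2 = 2 * ((norm x)\<^sup>2 + M\<^sup>2)" for x
    by (simp add: R_def)
  have D0: "0 \<le> D"
    using order_trans[OF abs_ge_zero close] u by (rule nonneg_of_mult_pos)
  have pointwise: "norm (score_deriv v \<mu> x h - score_deriv u \<mu> x h)
      \<le> 4 * D * real CARD('n) * (1 + 2 * (R x)\<^sup>2) * norm h" for x
  proof (cases "CARD('n) = 1") \<comment> \<open>the generic factor \<open>1 + 3 R\<^sup>2\<close> fits below \<open>n (1 + 2 R\<^sup>2)\<close> only for \<open>n \<ge> 2\<close>\<close>
    case True
    then obtain j :: 'n where j: "UNIV = {j}"
      by (rule card_1_singletonE)
    \<comment> \<open>A sole component has responsibility 1 whatever its weight, so the two score
      derivatives coincide.\<close>
    have "resp v \<mu> x j = 1" "resp u \<mu> x j = 1"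
      using sum_resp[of v \<mu> x] sum_resp[of u \<mu> x] v u by (simp_all add: j)
    moreover have "i = j" for i
      using j by auto
    ultimately have "resp v \<mu> x i = 1" "resp u \<mu> x i = 1" for i
      by (metis, metis)
    then have "score_deriv v \<mu> x h - score_deriv u \<mu> x h = 0"
      by (simp add: score_deriv_def score_def)
    then show ?thesis
      using D0 by simp
  next
    case False
    then have n: "real CARD('n) \<ge> 2"
      using zero_less_card_finite[where 'a = 'n] by linarith
    have "norm (score_deriv v \<mu> x h - score_deriv u \<mu> x h) \<le> 4 * D * (1 + 3 * (R x)\<^sup>2) * norm h"
      using resp_diff_le[OF close v u D] v u R D0 by (intro norm_score_deriv_diff_le) auto
    also have "\<dots> \<le> 4 * D * (real CARD('n) * (1 + 2 * (R x)\<^sup>2)) * norm h"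
    proof -
      have "1 + 3 * (R x)\<^sup>2 \<le> 2 * (1 + 2 * (R x)\<^sup>2)"
        by simp
      also have "\<dots> \<le> real CARD('n) * (1 + 2 * (R x)\<^sup>2)"
        using n by (intro mult_right_mono) auto
      finally show ?thesis
        using D0 by (intro mult_right_mono mult_left_mono) auto
    qed
    finally show ?thesis by (simp add: mult.assoc)
  qed
  have "hess (\<lambda>\<mu>. pop_loss \<mu>s ws \<mu> v) \<mu> h - hess (\<lambda>\<mu>. pop_loss \<mu>s ws \<mu> u) \<mu> h
      = (\<integral>x. score_deriv v \<mu> x h - score_deriv u \<mu> x h \<partial>P)"
    unfolding hess_pop_loss[OF v] hess_pop_loss[OF u]
    by (intro Bochner_Integration.integral_diff[symmetric] integrable_score_deriv v u)
  also have "norm \<dots> \<le> (\<integral>x. 4 * D * real CARD('n) * (1 + 2 * (R x)\<^sup>2) * norm h \<partial>P)"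
    using pointwise
    by (intro norm_lebesgue_integral_le Bochner_Integration.integrable_diff integrable_score_deriv v u)
      (auto simp: R2)
  also have "\<dots> = 4 * D * real CARD('n) * (1 + 4 * (second_moment \<mu>s ws + M\<^sup>2)) * norm h"
    by (simp add: R2 second_moment_def prob_UNIV)
  finally show ?thesis .
qed

end

section \<open>Reference weights and assembly of the constants\<close>

lemma norm_le_max_mean_norm:
  fixes U :: "((real ^ 'd) ^ 'n) set"
  assumes "compact U" "\<mu> \<in> U"
  shows "norm (\<mu> $ i) \<le> max_mean_norm U"
proof -
  obtain B where B: "\<And>\<nu>. \<nu> \<in> U \<Longrightarrow> norm \<nu> \<le> B"
    using compact_imp_bounded[OF assms(1)] by (auto simp: bounded_iff)
  \<comment> \<open>A supremum of reals is an upper bound only for bounded sets; compactness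
    supplies this.\<close>
  have "bdd_above ((\<lambda>\<mu>. MAX i. norm (\<mu> $ i)) ` U)"
    by (intro bdd_aboveI2[where M = B]) (simp, metis B Finite_Cartesian_Product.norm_nth_le order_trans)
  then have "(MAX i. norm (\<mu> $ i)) \<le> max_mean_norm U"
    unfolding max_mean_norm_def using assms(2) by (intro cSUP_upper)
  then show ?thesis
    by (meson Max_ge UNIV_I finite finite_imageI imageI order_trans)
qed

lemma ref_weight_eq:
  assumes "disjoint_family S" "i \<in> S l"
  shows "ref_weight S ws w i = w i * ws l / cluster_weight S w l"
proof -
  have "(THE l. i \<in> S l) = l"
    using assms by (intro the_equality) (auto simp: disjoint_family_on_def)
  then show ?thesis
    by (simp add: ref_weight_def Let_def)
qed

lemma cluster_weight_pos:
  fixes S :: "'m \<Rightarrow> 'n::finite set"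
  assumes "\<And>i. w i > 0" "S l \<noteq> {}"
  shows "cluster_weight S w l > 0"
  unfolding cluster_weight_def using assms by (intro sum_pos) auto

text \<open>Within a cluster all weights are rescaled by one factor, so measured against the
  reference weight the relative error of each is exactly the mismatch of its cluster.\<close>

lemma ref_weight_close:
  fixes S :: "'m::finite \<Rightarrow> 'n::finite set"
  assumes S: "disjoint_family S" "i \<in> S l" and w: "\<And>i. w i > 0" and ws: "\<And>l. ws l > 0"
  shows "ref_weight S ws w i > 0"
    and "\<bar>w i - ref_weight S ws w i\<bar> \<le> weight_mismatch S ws w * ref_weight S ws w i"
proof -
  have c: "cluster_weight S w l > 0"
    using w S(2) by (intro cluster_weight_pos) auto
  show pos: "ref_weight S ws w i > 0"
    using S c w[of i] ws[of l] by (simp add: ref_weight_eq)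
  have "\<bar>cluster_weight S w l - ws l\<bar> / ws l \<le> weight_mismatch S ws w"
    unfolding weight_mismatch_def by (intro Max_ge) auto
  then have "\<bar>cluster_weight S w l - ws l\<bar> / ws l * ref_weight S ws w i \<le> weight_mismatch S ws w * ref_weight S ws w i"
    using pos by (intro mult_right_mono) auto
  moreover have "w i - ref_weight S ws w i = (cluster_weight S w l - ws l) / ws l * ref_weight S ws w i"
    using c ws[of l] S by (simp add: ref_weight_eq field_simps)
  ultimately show "\<bar>w i - ref_weight S ws w i\<bar> \<le> weight_mismatch S ws w * ref_weight S ws w i"
    using pos ws[of l] by (simp add: abs_mult)
qed

text \<open>The first two conjuncts ensure that the integrals, \<open>grad\<close> and
  \<open>hess\<close> in the bounds are genuine rather than default values. The suprema are taken in
  \<open>ereal\<close>, where they need no prior boundedness proof and also make sense for empty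
  \<open>U\<close>.\<close>

theorem propositionC3:
  fixes \<mu>s :: "(real ^ 'd) ^ 'm"
    and ws :: "'m \<Rightarrow> real"
    and S :: "'m \<Rightarrow> 'n::finite set"
    and w :: "'n \<Rightarrow> real"
    and U :: "((real ^ 'd) ^ 'n) set"
  defines "w_min \<equiv> (MIN l. ws l)"
    and "\<Delta> \<equiv> weight_mismatch S ws w"
    and "w_ref \<equiv> ref_weight S ws w"
    and "L \<equiv> (\<lambda>v \<mu>. pop_loss \<mu>s ws \<mu> v)"
    and "M \<equiv> max_mean_norm U"
    and "m2 \<equiv> second_moment \<mu>s ws"
  defines "c0 \<equiv> w_min / 2"
    and "C0 \<equiv> 2 * (1 + 1 / w_min)"
  defines "CU0 \<equiv> 1 / c0"
    and "CU1 \<equiv> C0 * sqrt (2 * real CARD('n) * (m2 + M\<^sup>2))"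
    and "CU2 \<equiv> C0 * real CARD('n) * (1 + 2 * (2 + C0 * \<Delta>) * (m2 + M\<^sup>2))"
  assumes "ws \<in> prob_simplex" and "w_min > 0"
    and "disjoint_family S" and "(\<Union>l. S l) = UNIV" and "\<And>l. S l \<noteq> {}"
    and "w \<in> prob_simplex" and "\<And>i. w i > 0"
    and "compact U"
    and "\<Delta> \<le> 1 / 2"
  shows "integrable (mixture_measure \<mu>s ws) (\<lambda>x. (norm x)\<^sup>2)
    \<and> (\<forall>v\<in>{w, w_ref}. \<forall>\<mu>. integrable (mixture_measure \<mu>s ws) (log_ratio \<mu>s ws \<mu> v)
           \<and> L v differentiable (at \<mu>) \<and> grad (L v) differentiable (at \<mu>))
    \<and> (SUP \<mu>\<in>U. ereal \<bar>L w \<mu> - L w_ref \<mu>\<bar>) \<le> ereal (CU0 * \<Delta>)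
    \<and> (SUP \<mu>\<in>U. ereal (norm (grad (L w) \<mu> - grad (L w_ref) \<mu>))) \<le> ereal (CU1 * \<Delta>)
    \<and> (SUP \<mu>\<in>U. ereal (onorm (\<lambda>h. hess (L w) \<mu> h - hess (L w_ref) \<mu> h))) \<le> ereal (CU2 * \<Delta>)"
proof -
  have w_min_le: "w_min \<le> ws l" for l
    unfolding w_min_def by (intro Min_le) auto
  have ws: "ws l > 0" for l
    using \<open>w_min > 0\<close> w_min_le by (rule less_le_trans)
  interpret mixture_model \<mu>s ws
    using ws \<open>ws \<in> prob_simplex\<close> by unfold_locales
  note w = \<open>\<And>i. w i > 0\<close>
  have ref: "w_ref i > 0" and close: "\<bar>w i - w_ref i\<bar> \<le> \<Delta> * w_ref i" for i
  proof -
    obtain l where l: "i \<in> S l"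
      using \<open>(\<Union>l. S l) = UNIV\<close> by blast
    show "w_ref i > 0"
      unfolding w_ref_def using \<open>disjoint_family S\<close> l w ws by (rule ref_weight_close)
    show "\<bar>w i - w_ref i\<bar> \<le> \<Delta> * w_ref i"
      unfolding w_ref_def \<Delta>_def using \<open>disjoint_family S\<close> l w ws by (rule ref_weight_close)
  qed
  have \<Delta>0: "0 \<le> \<Delta>"
    using order_trans[OF abs_ge_zero close] ref by (rule nonneg_of_mult_pos)
  \<comment> \<open>This makes \<open>CU0\<close> at least 2 and \<open>C0\<close> at least 4, so
    they absorb the numerical factors of the comparison lemmas.\<close>
  have "w_min \<le> 1"
  proof -
    have "ws undefined \<le> (\<Sum>l\<in>UNIV. ws l)"
      using ws by (intro member_le_sum) (auto simp: less_imp_le)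
    then show ?thesis
      using w_min_le[of undefined] \<open>ws \<in> prob_simplex\<close> by (simp add: prob_simplex_def)
  qed
  then have CU0: "2 \<le> CU0" and C0: "4 \<le> C0"
    using \<open>w_min > 0\<close> by (simp_all add: CU0_def c0_def C0_def field_simps)
  have m2: "0 \<le> m2"
    unfolding m2_def second_moment_def by (rule integral_nonneg_AE) simp
  have n: "1 \<le> real CARD('n)"
    using zero_less_card_finite[where 'a = 'n] by linarith
  have M: "norm (\<mu> $ i) \<le> M" if "\<mu> \<in> U" for \<mu> i
    unfolding M_def using \<open>compact U\<close> that by (rule norm_le_max_mean_norm)

  have "integrable P (log_ratio \<mu>s ws \<mu> v) \<and> L v differentiable (at \<mu>) \<and> grad (L v) differentiable (at \<mu>)"
    if "v \<in> {w, w_ref}" for v \<mu>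
  proof -
    have "v i > 0" for i
      using that w ref by auto
    then show ?thesis
      unfolding L_def differentiable_def
      using integrable_log_ratio has_derivative_pop_loss has_derivative_grad_pop_loss by blast
  qed
  moreover have "\<bar>L w \<mu> - L w_ref \<mu>\<bar> \<le> CU0 * \<Delta>" for \<mu>
  proof -
    have "\<bar>L w \<mu> - L w_ref \<mu>\<bar> \<le> 2 * \<Delta>"
      unfolding L_def using close w ref \<open>\<Delta> \<le> 1 / 2\<close> by (rule pop_loss_diff_le)
    then show ?thesis
      using mult_right_mono[OF CU0 \<Delta>0] by simp
  qed
  moreover have "norm (grad (L w) \<mu> - grad (L w_ref) \<mu>) \<le> CU1 * \<Delta>" if "\<mu> \<in> U" for \<mu>
  proof -
    have "norm (grad (L w) \<mu> - grad (L w_ref) \<mu>) \<le> 4 * \<Delta> * sqrt (2 * (m2 + M\<^sup>2))"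
      unfolding L_def m2_def using close w ref \<open>\<Delta> \<le> 1 / 2\<close> M[OF that] by (rule grad_pop_loss_diff_le)
    \<comment> \<open>The factor \<open>n\<close> under the root only enlarges the bound, since
      \<open>n\<close> is at least 1.\<close>
    also have "\<dots> \<le> C0 * \<Delta> * sqrt (2 * real CARD('n) * (m2 + M\<^sup>2))"
      using C0 \<Delta>0 m2 n mult_right_mono[OF n, of "m2 + M\<^sup>2"]
      by (intro mult_mono mult_right_mono real_sqrt_le_mono) (auto simp: mult.assoc)
    finally show ?thesis
      by (simp add: CU1_def mult_ac)
  qed
  moreover have "onorm (\<lambda>h. hess (L w) \<mu> h - hess (L w_ref) \<mu> h) \<le> CU2 * \<Delta>" if "\<mu> \<in> U" for \<mu>
  proof (rule onorm_le)
    fix h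
    have "norm (hess (L w) \<mu> h - hess (L w_ref) \<mu> h)
        \<le> 4 * \<Delta> * real CARD('n) * (1 + 4 * (m2 + M\<^sup>2)) * norm h"
      unfolding L_def m2_def using close w ref \<open>\<Delta> \<le> 1 / 2\<close> M[OF that] by (rule hess_pop_loss_diff_le)
    also have "\<dots> \<le> C0 * \<Delta> * real CARD('n) * (1 + 2 * (2 + C0 * \<Delta>) * (m2 + M\<^sup>2)) * norm h"
    proof -
      \<comment> \<open>The term \<open>C0 * \<Delta>\<close> is nonnegative, so adding it to 2 is
        harmless.\<close>
      have "4 * (m2 + M\<^sup>2) \<le> 2 * (2 + C0 * \<Delta>) * (m2 + M\<^sup>2)"
        using C0 \<Delta>0 m2 by (intro mult_right_mono) auto
      then show ?thesis
        using C0 \<Delta>0 m2 by (intro mult_right_mono mult_mono) auto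
    qed
    finally show "norm (hess (L w) \<mu> h - hess (L w_ref) \<mu> h) \<le> CU2 * \<Delta> * norm h"
      by (simp add: CU2_def mult_ac)
  qed
  ultimately show ?thesis
    by (auto intro!: SUP_least integrable_norm_sq)
qed

end
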